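(* Let $n$ be a positive integer. Then, modulo $\Phi_n(q)^2$, $$\left(\binom{2n}{n}\right)_q\equiv \begin{cases}2(-1)^m(1+q^m)q^{m(3m-1)/2}-3m(1-q^{3m}), & \text{if } n=3m,\\ 2(-1)^m q^{m(3m+1)/2}-(3m+1)(1-q^{3m+1}), & \text{if } n=3m+1,\\ 2(-1)^m q^{m(3m-1)/2}-(3m-1)(1-q^{3m-1}), & \text{if } n=3m-1,\end{cases}$$ where in each case $m$ is the (non-negative) integer determined by $n$ through the indicated relation.
   Context: Here $q$ is an indeterminate. The $q$-binomial coefficients are ${n\brack k}=\dfrac{(1-q^n)(1-q^{n-1})\cdots(1-q^{n-k+1})}{(1-q)(1-q^2)\cdots(1-q^k)}$ if $0\le k\le n$, and ${n\brack k}=0$ otherwise; they are polynomials in $\mathbb{Z}[q]$. The (Andrews–Baxter) $q$-trinomial coefficients are defined by $$\left(\binom{n}{j}\right)_q=\sum_{k=0}^{n}q^{k(k+j)}{n\brack k}{n-k\brack k+j},$$ so that $\left(\binom{2n}{n}\right)_q=\sum_{k=0}^{2n}q^{k(k+n)}{2n\brack k}{2n-k\brack k+n}$. The polynomial $\Phi_n(q)=\prod_{1\le k\le n,\ \gcd(n,k)=1}(q-\zeta^k)$, with $\zeta$ a primitive $n$th root of unity, is the $n$th cyclotomic polynomial. For polynomials $A(q),B(q),P(q)\in\mathbb{Z}[q]$, the congruence $A(q)\equiv B(q)\pmod{P(q)}$ means that $P(q)$ divides $A(q)-B(q)$. *)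

theory Defs
  imports
    "HOL-Complex_Analysis.Complex_Analysis"
    "HOL-Computational_Algebra.Computational_Algebra"
begin

abbreviation q :: "int poly" where
  "q \<equiv> [:0, 1:]"

text \<open>
  The quotient is an exact division in \<open>\<int>[q]\<close>; see \<open>qbinom_exact\<close> below.
  The lower index is an integer so that it may be negative.
\<close>

definition qbinom :: "nat \<Rightarrow> int \<Rightarrow> int poly" where
  "qbinom n k =
     (if 0 \<le> k \<and> k \<le> int n
      then (\<Prod>i=1..nat k. 1 - q ^ (n - i + 1)) div (\<Prod>i=1..nat k. 1 - q ^ i)
      else 0)"

text \<open>
  If \<open>k * (k + j) < 0\<close>, then \<open>k + j < 0\<close> and the second \<open>q\<close>-binomial coefficient
  vanishes, so the truncation by \<open>nat\<close> in the exponent is harmless.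
\<close>

definition qtrinom :: "nat \<Rightarrow> int \<Rightarrow> int poly" where
  "qtrinom n j =
     (\<Sum>k=0..n. q ^ nat (int k * (int k + j)) * qbinom n (int k) * qbinom (n - k) (int k + j))"

definition cyclotomic_complex :: "nat \<Rightarrow> complex poly" where
  "cyclotomic_complex n =
     (let \<zeta> = cis (2 * pi / real n) in \<Prod>k | 1 \<le> k \<and> k \<le> n \<and> gcd n k = 1. [:- (\<zeta> ^ k), 1:])"

text \<open>
  The polynomial in \<open>\<int>[q]\<close> whose image in \<open>\<complex>[q]\<close> is the above product. See
  \<open>of_int_cyclotomic\<close> below for its existence and \<open>map_poly_of_int_inj\<close> for its uniqueness.
\<close>

definition cyclotomic :: "nat \<Rightarrow> int poly" where
  "cyclotomic n = (THE p. map_poly of_int p = cyclotomic_complex n)"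

lemma qbinom_denominator_dvd:
  "(\<Prod>i=1..k. 1 - q ^ i) dvd (\<Prod>i=1..k. 1 - q ^ (n + 1 - i))"
proof (induction n arbitrary: k)
  case 0
  show ?case
  proof (cases k)
    case (Suc l)
    have "(\<Prod>i=1..k. 1 - q ^ (0 + 1 - i)) = (0 :: int poly)"
      by (rule prod_zero) (auto intro!: bexI[of _ 1] simp: Suc)
    then show ?thesis by (metis dvd_0_right)
  qed simp
next
  case (Suc n)
  define D :: "nat \<Rightarrow> int poly" where "D = (\<lambda>k. \<Prod>i=1..k. 1 - q ^ i)"
  define N :: "nat \<Rightarrow> nat \<Rightarrow> int poly" where "N = (\<lambda>n k. \<Prod>i=1..k. 1 - q ^ (n + 1 - i))"
  have IH: "D k dvd N n k" for k
    using Suc.IH[of k] by (simp only: D_def N_def)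
  have "D k dvd N (Suc n) k"
  proof (cases k)
    case 0
    then show ?thesis by (simp add: D_def)
  next
    case (Suc l)
    have D: "D (Suc l) = D l * (1 - q ^ Suc l)"
      by (simp only: D_def prod.nat_ivl_Suc')  (simp add: mult.commute)
    have N: "N n (Suc l) = N n l * (1 - q ^ (n - l))"
      by (simp only: N_def prod.nat_ivl_Suc')  (simp add: mult.commute)
    have N': "N (Suc n) (Suc l) = (1 - q ^ Suc n) * N n l"
    proof -
      have "N (Suc n) (Suc l) = (1 - q ^ (Suc n + 1 - 1)) * (\<Prod>i=Suc 1..Suc l. 1 - q ^ (Suc n + 1 - i))"
        unfolding N_def by (rule prod.atLeast_Suc_atMost) simp
      also have "(\<Prod>i=Suc 1..Suc l. 1 - q ^ (Suc n + 1 - i)) = N n l"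
        unfolding N_def by (subst prod.shift_bounds_cl_Suc_ivl) simp
      finally show ?thesis by simp
    qed
    have eq: "N (Suc n) (Suc l) = (1 - q ^ Suc l) * N n l + q ^ Suc l * N n (Suc l)"
    proof (cases "l \<le> n")
      case True
      have "q ^ Suc l * q ^ (n - l) = q ^ Suc n"
        using True by (simp only: power_add[symmetric]) simp
      moreover have "(1 - a) * x + a * (x * (1 - b)) = (1 - a * b) * x" for a b x :: "int poly"
        by (simp add: algebra_simps)
      ultimately show ?thesis unfolding N N' by metis
    next
      case False
      have "N n l = 0"
        unfolding N_def by (rule prod_zero) (use False in \<open>auto intro!: bexI[of _ "Suc n"]\<close>)
      then show ?thesis by (simp only: N N' mult_zero_left mult_zero_right add_0)
    qed
    have "D (Suc l) dvd (1 - q ^ Suc l) * N n l"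
      unfolding D mult.commute[of "D l"] by (intro mult_dvd_mono dvd_refl IH)
    moreover have "D (Suc l) dvd q ^ Suc l * N n (Suc l)"
      by (intro dvd_mult IH)
    ultimately show ?thesis unfolding Suc eq by (rule dvd_add)
  qed
  then show ?case by (simp only: D_def N_def)
qed

lemma qbinom_exact:
  assumes "0 \<le> k" "k \<le> int n"
  shows "qbinom n k * (\<Prod>i=1..nat k. 1 - q ^ i) = (\<Prod>i=1..nat k. 1 - q ^ (n - i + 1))"
proof -
  have "(\<Prod>i=1..nat k. 1 - q ^ (n - i + 1)) = (\<Prod>i=1..nat k. 1 - q ^ (n + 1 - i))"
  proof (rule prod.cong[OF refl])
    fix i assume "i \<in> {1..nat k}"
    then have "n - i + 1 = n + 1 - i" using assms by auto
    then show "1 - q ^ (n - i + 1) = 1 - q ^ (n + 1 - i)" by metis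
  qed
  then have "(\<Prod>i=1..nat k. 1 - q ^ i) dvd (\<Prod>i=1..nat k. 1 - q ^ (n - i + 1))"
    using qbinom_denominator_dvd[where k = "nat k" and n = n] by metis
  then show ?thesis
    using assms by (simp only: qbinom_def dvd_div_mult_self if_True simp_thms)
qed

lemma cyclotomic_complex_altdef:
  "cyclotomic_complex n =
     (\<Prod>k | 1 \<le> k \<and> k \<le> n \<and> gcd n k = 1. [:- cis (2 * pi * (real k / real n)), 1:])"
  unfolding cyclotomic_complex_def Let_def Complex.DeMoivre
  by (intro prod.cong refl) (simp add: mult_ac)

lemma prod_cyclotomic_complex:
  assumes "n > 0"
  shows "(\<Prod>d | d dvd n. cyclotomic_complex d) = monom 1 n - 1"
proof -
  define f where "f = (\<lambda>x :: real. [:- cis (2 * pi * x), 1:])"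
  have fin: "finite {k. 1 \<le> k \<and> k \<le> d \<and> gcd d k = 1}" for d :: nat
    by (rule finite_subset[of _ "{..d}"]) auto
  have "(\<Prod>d | d dvd n. cyclotomic_complex d) =
        (\<Prod>(d, k) \<in> (SIGMA d:{d. d dvd n}. {k. 1 \<le> k \<and> k \<le> d \<and> gcd d k = 1}). f (real k / real d))"
    using assms fin by (subst prod.Sigma[symmetric]) (auto simp: cyclotomic_complex_altdef f_def)
  also have "\<dots> = (\<Prod>k\<in>{1..n}. f (real k / real n))"
  proof (rule prod.reindex_bij_witness[where
           i = "\<lambda>k. (n div gcd n k, k div gcd n k)" and j = "\<lambda>(d, k). k * (n div d)"], goal_cases)
    case (1 a)
    then obtain d k where a: "a = (d, k)" "d dvd n" "1 \<le> k" "k \<le> d" "coprime d k"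
      by (auto simp: coprime_iff_gcd_eq_1)
    from a(2) obtain e where e: "n = d * e" by blast
    have pos: "d > 0" "e > 0" using e assms by auto
    have "gcd n (k * e) = e"
      using a(5) by (simp add: e gcd_mult_distrib_nat[symmetric] mult.commute[of _ e])
    then show ?case using pos by (simp add: a e)
  next
    case (2 a)
    then obtain d k where a: "a = (d, k)" "d dvd n" "1 \<le> k" "k \<le> d"
      by auto
    from a(2) obtain e where e: "n = d * e" by blast
    then show ?case using assms a by (auto simp: e)
  next
    case (3 k)
    have "n div gcd n k > 0" using assms by (simp add: div_greater_zero_iff dvd_imp_le)
    moreover have "n div (n div gcd n k) = gcd n k"
      using assms by (simp add: div_div_eq_right)
    ultimately show ?case by simp
  next
    case (4 k)
    have "gcd (n div gcd n k) (k div gcd n k) = 1"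
      using assms by (intro div_gcd_coprime[unfolded coprime_iff_gcd_eq_1]) auto
    moreover have "k div gcd n k \<ge> 1"
      using 4 assms by (simp add: Suc_le_eq div_greater_zero_iff)
    moreover have "k div gcd n k \<le> n div gcd n k"
      using 4 by (auto intro: div_le_mono)
    moreover have "n div gcd n k dvd n"
      by (rule dvdI[of _ _ "gcd n k"]) simp
    ultimately show ?case by auto
  next
    case (5 a)
    then obtain d k where a: "a = (d, k)" "d dvd n"
      by auto
    from a(2) obtain e where e: "n = d * e" by blast
    then show ?case using assms by (auto simp: a e)
  qed
  also have "\<dots> = (\<Prod>k\<in>{1..n}. [:- cis (2 * pi * (real k / real n)), 1:])"
    by (simp add: f_def)
  also have "\<dots> = (\<Prod>z | z ^ n = 1. [:- z, 1:])"
  proof -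
    let ?g = "\<lambda>k :: nat. cis (2 * pi * (real k / real n))"
    have img: "?g ` {..<n} = {z. z ^ n = 1}"
      using Complex.bij_betw_roots_unity[OF assms] by (simp add: bij_betw_def)
    have "?g n = ?g 0" using assms by simp
    then have "?g ` {1..n} = ?g ` {..<n}"
    proof (intro equalityI image_subsetI, goal_cases)
      case (1 k)
      then show ?case using assms by (cases "k = n") (auto intro!: image_eqI[of _ _ 0])
    next
      case (2 k)
      then show ?case using assms
        by (cases "k = 0") (auto intro: image_eqI[of _ _ n] image_eqI[of _ _ k])
    qed
    then have img': "?g ` {1..n} = {z. z ^ n = 1}" using img by simp
    moreover have "inj_on ?g {1..n}"
      by (rule eq_card_imp_inj_on) (use assms in \<open>simp_all only: img' card_roots_unity_eq, simp_all\<close>)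
    ultimately have "bij_betw ?g {1..n} {z. z ^ n = 1}" by (simp add: bij_betw_def)
    from prod.reindex_bij_betw[OF this] show ?thesis by simp
  qed
  also have "\<dots> = monom 1 n - 1"
  proof (rule poly_eqI_degree_lead_coeff[where A = "{z. z ^ n = 1}" and n = n])
    have deg: "degree (\<Prod>z | z ^ n = 1. [:- z, 1 :: complex:]) = n"
      using assms by (subst degree_prod_sum_eq) (simp_all add: card_roots_unity_eq)
    then show "degree (\<Prod>z | z ^ n = 1. [:- z, 1 :: complex:]) \<le> n" by simp
    have "coeff (\<Prod>z | z ^ n = 1. [:- z, 1 :: complex:]) n = lead_coeff (\<Prod>z | z ^ n = 1. [:- z, 1 :: complex:])"
      by (simp only: deg)
    also have "\<dots> = 1" by (simp add: lead_coeff_prod)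
    finally show "coeff (\<Prod>z | z ^ n = 1. [:- z, 1 :: complex:]) n = coeff (monom 1 n - 1) n"
      using assms by simp
    show "degree (monom 1 n - 1 :: complex poly) \<le> n"
      by (intro degree_diff_le) (simp_all add: degree_monom_le)
    show "card {z :: complex. z ^ n = 1} \<ge> n" using assms by (simp add: card_roots_unity_eq)
    fix z :: complex assume "z \<in> {z. z ^ n = 1}"
    moreover have "finite {z :: complex. z ^ n = 1}" using assms by (simp add: finite_roots_unity)
    ultimately show "poly (\<Prod>z | z ^ n = 1. [:- z, 1:]) z = poly (monom 1 n - 1) z"
      by (auto simp: poly_prod poly_monom prod_zero_iff)
  qed
  finally show ?thesis .
qed

lemma map_poly_of_int_mult:
  "map_poly of_int (a * b) = (map_poly of_int a * map_poly of_int b :: complex poly)"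
  by (intro poly_eqI) (simp add: coeff_map_poly coeff_mult)

lemma map_poly_of_int_prod:
  "map_poly of_int (\<Prod>x\<in>A. f x) = (\<Prod>x\<in>A. map_poly of_int (f x) :: complex poly)"
  by (induction A rule: infinite_finite_induct) (simp_all add: map_poly_of_int_mult)

lemma map_poly_of_int_inj:
  "map_poly of_int a = (map_poly of_int b :: complex poly) \<Longrightarrow> a = b"
  by (simp add: poly_eq_iff coeff_map_poly)

lemma degree_map_poly_of_int: "degree (map_poly of_int a :: complex poly) = degree a"
  by (rule degree_map_poly) simp

lemma monic_quotient_of_int:
  fixes g :: "complex poly"
  assumes "map_poly of_int a = map_poly of_int p * g" "lead_coeff p = 1"
  shows "\<exists>h. g = map_poly of_int h"
proof -
  obtain h r where hr: "pseudo_divmod a p = (h, r)" by (cases "pseudo_divmod a p")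
  have p: "p \<noteq> 0" using assms(2) by auto
  from pseudo_divmod[OF p hr] have a: "a = p * h + r" and r: "r = 0 \<or> degree r < degree p"
    by (simp_all add: assms(2))
  have "map_poly of_int a = (map_poly of_int p * map_poly of_int h + map_poly of_int r :: complex poly)"
    unfolding map_poly_of_int_mult[symmetric] a by (intro poly_eqI) (simp add: coeff_map_poly)
  then have eq: "map_poly of_int p * (g - map_poly of_int h) = (map_poly of_int r :: complex poly)"
    unfolding assms(1) by (simp add: algebra_simps)
  have "g - map_poly of_int h = 0"
  proof (rule ccontr)
    assume nz: "g - map_poly of_int h \<noteq> 0"
    have "(map_poly of_int p :: complex poly) \<noteq> 0"
      using p map_poly_of_int_inj[of p 0] by auto
    then have "degree p \<le> degree r" "map_poly of_int r \<noteq> (0 :: complex poly)"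
      using nz eq degree_mult_eq[of "map_poly of_int p" "g - map_poly of_int h"]
        mult_eq_0_iff[of "map_poly of_int p" "g - map_poly of_int h"]
      by (simp_all add: degree_map_poly_of_int)
    then show False using r by auto
  qed
  then show ?thesis by auto
qed

lemma of_int_cyclotomic_exists:
  "n > 0 \<Longrightarrow> \<exists>p. map_poly of_int p = cyclotomic_complex n \<and> lead_coeff p = 1"
proof (induction n rule: less_induct)
  case (less n)
  have "\<exists>P. \<forall>d\<in>{d. d dvd n \<and> d < n}. map_poly of_int (P d) = cyclotomic_complex d \<and> lead_coeff (P d) = 1"
    by (rule bchoice) (use less.prems in \<open>auto intro!: less.IH intro: dvd_pos_nat\<close>)
  then obtain P where P: "\<And>d. d dvd n \<Longrightarrow> d < n \<Longrightarrow> map_poly of_int (P d) = cyclotomic_complex d"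
    "\<And>d. d dvd n \<Longrightarrow> d < n \<Longrightarrow> lead_coeff (P d) = 1"
    by auto
  define R where "R = (\<Prod>d | d dvd n \<and> d < n. P d)"
  have R: "map_poly of_int R = (\<Prod>d | d dvd n \<and> d < n. cyclotomic_complex d)"
    unfolding R_def map_poly_of_int_prod by (intro prod.cong) (auto simp: P)
  have "lead_coeff R = (\<Prod>d | d dvd n \<and> d < n. lead_coeff (P d))"
    unfolding R_def by (rule lead_coeff_prod)
  also have "\<dots> = 1" by (intro prod.neutral) (auto simp: P)
  finally have lR: "lead_coeff R = 1" .
  have "{d. d dvd n} = insert n {d. d dvd n \<and> d < n}"
    using less.prems by (auto dest: dvd_imp_le)
  then have "monom 1 n - 1 = (map_poly of_int R * cyclotomic_complex n :: complex poly)"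
    unfolding prod_cyclotomic_complex[OF less.prems, symmetric] R by (simp add: mult.commute)
  moreover have "map_poly of_int (monom 1 n - 1) = (monom 1 n - 1 :: complex poly)"
    by (intro poly_eqI) (simp add: coeff_map_poly)
  ultimately obtain h where h: "cyclotomic_complex n = map_poly of_int h"
    using monic_quotient_of_int[OF _ lR] by metis
  have "of_int (lead_coeff h) = lead_coeff (cyclotomic_complex n)"
    by (simp add: h degree_map_poly_of_int coeff_map_poly)
  also have "\<dots> = 1" by (simp add: cyclotomic_complex_altdef lead_coeff_prod)
  finally show ?case using h by (intro exI[of _ h]) simp
qed

lemma of_int_cyclotomic:
  assumes "n > 0"
  shows "map_poly of_int (cyclotomic n) = cyclotomic_complex n"
  unfolding cyclotomic_def
  by (rule theI') (metis of_int_cyclotomic_exists[OF assms] map_poly_of_int_inj)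

end

theory Submission
  imports Defs "HOL-Computational_Algebra.Field_as_Ring"
begin

text \<open>
  Write \<open>[n; k]\<close> for the \<open>q\<close>-binomial coefficient, \<open>(q)\<^sub>k = (1 - q) \<dots> (1 - q\<^sup>k)\<close>, \<open>\<Phi> = \<Phi>\<^sub>n\<close> and
  \<open>T\<^sub>k = q\<^bsup>k(k + n)\<^esup> [2n; k] [2n - k; k + n]\<close> for the summands of the \<open>q\<close>-trinomial coefficient. They
  vanish when \<open>2k > n\<close>.

  The summand \<open>T\<^sub>0 = [2n; n]\<close> is not divisible by \<open>\<Phi>\<close>, and it is congruent to \<open>2 - n (1 - q\<^sup>n)\<close>
  modulo \<open>\<Phi>\<^sup>2\<close> (\<open>central_cong\<close>). This explains the last term of the three formulas.

  For \<open>1 \<le> k \<le> n/2\<close>, the summand is \<open>q\<^bsup>k(k + n)\<^esup> (q)\<^bsub>2n\<^esub> / ((q)\<^sub>k (q)\<^bsub>k + n\<^esub> (q)\<^bsub>n - 2k\<^esub>)\<close>, where the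
  numerator contains two factors divisible by \<open>\<Phi>\<close> (namely \<open>1 - q\<^sup>n\<close> and \<open>1 - q\<^bsup>2n\<^esup>\<close>) and the denominator
  only one. So \<open>T\<^sub>k\<close> is \<open>1 - q\<^sup>n\<close> times a fraction with denominator prime to \<open>\<Phi>\<close>; it matters only modulo \<open>\<Phi>\<close>, where
  \<open>q\<^sup>n\<close> is \<open>1\<close>. Together with the reflection \<open>q\<^sup>i (1 - q\<^bsup>n - i\<^esup>) \<equiv> -(1 - q\<^sup>i)\<close> this gives
  \<open>T\<^sub>k \<equiv> 2 (-1)\<^sup>k q\<^bsup>k(k - 1)/2\<^esup> V\<^sub>k\<close> with \<open>V\<^sub>k = (1 - q\<^sup>n) / (1 - q\<^bsup>n - k\<^esup>) [n - k; k]\<close> (\<open>term_cong\<close>).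

  It remains to sum \<open>(-1)\<^sup>k q\<^bsup>k(k - 1)/2\<^esup> V\<^sub>k\<close> over all \<open>k \<ge> 0\<close>, where \<open>V\<^sub>0 = 1\<close>. Since
  \<open>1 - q\<^sup>n = (1 - q\<^bsup>n - k\<^esup>) + q\<^bsup>n - k\<^esup> (1 - q\<^sup>k)\<close>, one has
  \<open>V\<^sub>k = [n - k; k] + q\<^bsup>n - k\<^esup> [n - k - 1; k - 1]\<close>, so for \<open>n \<ge> 2\<close> the sum equals \<open>F\<^sub>n - q\<^bsup>n - 1\<^esup> F\<^bsub>n - 2\<^esub>\<close> with
  \<open>F\<^sub>n = \<Sum>\<^sub>k (-1)\<^sup>k q\<^bsup>k(k - 1)/2\<^esup> [n - k; k]\<close>. The two Pascal rules yield \<open>F\<^bsub>n + 3\<^esub> = - q\<^bsup>n + 1\<^esup> F\<^sub>n\<close>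
  (\<open>pent_rec\<close>), whence \<open>F\<^sub>n\<close> is zero or a signed power of \<open>q\<close> with a pentagonal exponent, depending
  on \<open>n\<close> modulo 3. This is where the three cases come from.

  All congruences are obtained after multiplying by factors \<open>1 - q\<^sup>i\<close> with \<open>n\<close> not dividing \<open>i\<close>, and by \<open>2\<close>.
  These may be cancelled modulo \<open>\<Phi>\<^sup>2\<close> because they do not vanish at the primitive \<open>n\<close>th roots of unity,
  so that they are coprime to \<open>\<Phi>\<close> in \<open>\<complex>[q]\<close>, and because divisibility by the monic \<open>\<Phi>\<^sup>2\<close> descends from
  \<open>\<complex>[q]\<close> to \<open>\<int>[q]\<close> (\<open>cyclotomic_square_cancel\<close>).
\<close>

section \<open>Gaussian binomial coefficients and shifted factorials\<close>

text \<open>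
  The Gaussian binomial coefficient at an arbitrary ring element, by a Pascal rule instead of a
  quotient, so that it makes sense without division.
\<close>

fun gauss :: "'a::comm_ring_1 \<Rightarrow> nat \<Rightarrow> nat \<Rightarrow> 'a" where
  "gauss x n 0 = 1"
| "gauss x 0 (Suc k) = 0"
| "gauss x (Suc n) (Suc k) = x ^ Suc k * gauss x n (Suc k) + gauss x n k"

lemma gauss_eq_0: "n < k \<Longrightarrow> gauss x n k = 0"
  by (induction x n k rule: gauss.induct) auto

text \<open>The other Pascal rule, which reflects the symmetry of \<open>[n; k]\<close> under \<open>k \<mapsto> n - k\<close>.\<close>

lemma gauss_Suc_Suc':
  "gauss x (Suc n) (Suc k) = gauss x n (Suc k) + x ^ (n - k) * gauss x n k"
proof (induction n arbitrary: k)
  case 0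
  show ?case by (cases k) auto
next
  case (Suc n)
  consider "k = 0" | j where "k = Suc j" "k \<le> n" | "k = Suc n" | "k > Suc n"
    by (cases k) (auto, linarith)
  then show ?case
  proof cases
    case 1
    then show ?thesis
      using Suc.IH[of 0] by (simp add: algebra_simps)
  next
    case 2
    obtain d where n: "n = Suc (j + d)"
      using 2 less_iff_Suc_add[of j n] by auto
    have "gauss x (Suc (Suc n)) (Suc k) = x ^ Suc k * gauss x (Suc n) (Suc k) + gauss x (Suc n) k"
      by simp
    also have "\<dots> = x ^ Suc k * (gauss x n (Suc k) + x ^ (n - k) * gauss x n k) +
                 (gauss x n k + x ^ (n - j) * gauss x n j)"
      unfolding Suc.IH[of k] using Suc.IH[of j] 2 by simp
    also have "\<dots> = (x ^ Suc k * gauss x n (Suc k) + gauss x n k) +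
                 x ^ (Suc n - k) * (x ^ k * gauss x n k + gauss x n j)"
      using n 2 by (simp add: algebra_simps power_add)
    also have "\<dots> = gauss x (Suc n) (Suc k) + x ^ (Suc n - k) * gauss x (Suc n) k"
      using 2 by simp
    finally show ?thesis .
  next
    case 3
    then show ?thesis
      by (simp add: gauss_eq_0)
  qed (simp add: gauss_eq_0)
qed

text \<open>
  The \<open>q\<close>-Pochhammer symbol with parameter \<open>x\<^bsup>a + 1\<^esup>\<close> and base \<open>x\<close>; for \<open>a = 0\<close> it is the denominator
  of the Gaussian binomial coefficients.
\<close>

definition qpoch :: "'a::comm_ring_1 \<Rightarrow> nat \<Rightarrow> nat \<Rightarrow> 'a" where
  "qpoch x a k = (\<Prod>i=1..k. 1 - x ^ (a + i))"

lemma qpoch_0 [simp]: "qpoch x a 0 = 1"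
  by (simp add: qpoch_def)

lemma qpoch_Suc: "qpoch x a (Suc k) = qpoch x a k * (1 - x ^ (a + Suc k))"
  by (simp add: qpoch_def)

lemma qpoch_add: "qpoch x a (k + l) = qpoch x a k * qpoch x (a + k) l"
  by (induction l) (simp_all add: qpoch_Suc add.assoc mult.assoc)

lemma qpoch_Suc': "qpoch x a (Suc k) = (1 - x ^ Suc a) * qpoch x (Suc a) k"
  using qpoch_add[of x a 1 k] by (simp add: qpoch_Suc)

lemma gauss_mult_qpoch:
  "k \<le> n \<Longrightarrow> gauss x n k * qpoch x 0 k * qpoch x 0 (n - k) = qpoch x 0 n"
proof (induction x n k rule: gauss.induct)
  case (3 x n k)
  show ?case
  proof (cases "k = n")
    case True
    with "3.IH"(2) show ?thesis
      by (simp add: gauss_eq_0 qpoch_Suc mult.assoc[symmetric] del: power_Suc)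
  next
    case False
    with 3(3) obtain d where n: "n = Suc (k + d)"
      using less_iff_Suc_add[of k n] by auto
    have 1: "gauss x n (Suc k) * qpoch x 0 (Suc k) * qpoch x 0 d = qpoch x 0 n"
      using "3.IH"(1) by (simp add: n)
    have 2: "gauss x n k * qpoch x 0 k * qpoch x 0 (Suc d) = qpoch x 0 n"
      using "3.IH"(2) by (simp add: n)
    have "gauss x (Suc n) (Suc k) * qpoch x 0 (Suc k) * qpoch x 0 (Suc d) =
        x ^ Suc k * (1 - x ^ Suc d) * (gauss x n (Suc k) * qpoch x 0 (Suc k) * qpoch x 0 d) +
        (1 - x ^ Suc k) * (gauss x n k * qpoch x 0 k * qpoch x 0 (Suc d))"
      by (simp add: qpoch_Suc algebra_simps del: power_Suc)
    also have "\<dots> = qpoch x 0 n * (1 - x ^ (Suc k + Suc d))"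
      unfolding 1 2 power_add by (simp add: algebra_simps del: power_Suc)
    also have "\<dots> = qpoch x 0 (Suc n)"
      by (simp add: n qpoch_Suc)
    finally show ?thesis
      by (simp add: n)
  qed
qed auto

section \<open>Alternating sums with pentagonal values\<close>

text \<open>
  For \<open>e = 0\<close> this is the sum \<open>F\<^sub>n\<close> whose value is needed. The shift \<open>e = 1\<close> is the companion
  that makes the two Pascal rules close up into a recurrence.
\<close>

definition pent :: "'a::comm_ring_1 \<Rightarrow> nat \<Rightarrow> nat \<Rightarrow> 'a" where
  "pent x e n = (\<Sum>k\<le>n. (-1) ^ k * x ^ ((k + e) choose 2) * gauss x (n - k) k)"

lemma Suc_choose_two: "Suc k choose 2 = k + (k choose 2)"
  by (simp add: numeral_2_eq_2)

lemma pent_Suc: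
  "pent x e (Suc n) =
     x ^ (e choose 2) - (\<Sum>j\<le>n. (-1) ^ j * x ^ (Suc (j + e) choose 2) * gauss x (n - j) (Suc j))"
  unfolding pent_def sum.atMost_Suc_shift by (simp add: sum_negf)

text \<open>
  The same splitting in a form to which the Pascal rules apply: the summand for \<open>j = n + 1\<close> vanishes,
  and for \<open>j \<le> n\<close> the truncated difference \<open>Suc n - j\<close> is a successor.
\<close>

lemma pent_Suc_Suc:
  "pent x e (Suc (Suc n)) =
     x ^ (e choose 2) - (\<Sum>j\<le>n. (-1) ^ j * x ^ (Suc (j + e) choose 2) * gauss x (Suc (n - j)) (Suc j))"
proof -
  have "(\<Sum>j\<le>Suc n. (-1) ^ j * x ^ (Suc (j + e) choose 2) * gauss x (Suc n - j) (Suc j)) =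
        (\<Sum>j\<le>n. (-1) ^ j * x ^ (Suc (j + e) choose 2) * gauss x (Suc (n - j)) (Suc j))"
    by (simp add: Suc_diff_le del: gauss.simps(3))
  then show ?thesis
    by (simp only: pent_Suc)
qed

lemma pent_0_rec: "pent x 0 (Suc (Suc n)) = pent x 1 (Suc n) - pent x 1 n"
proof -
  have "(\<Sum>j\<le>n. (-1) ^ j * x ^ (Suc (j + 0) choose 2) * gauss x (Suc (n - j)) (Suc j)) =
        (\<Sum>j\<le>n. (-1) ^ j * x ^ (Suc (j + 1) choose 2) * gauss x (n - j) (Suc j)) + pent x 1 n"
    unfolding pent_def sum.distrib[symmetric]
    by (rule sum.cong) (simp_all add: Suc_choose_two power_add algebra_simps)
  then show ?thesis
    unfolding pent_Suc_Suc[of x 0 n] pent_Suc[of x 1 n] by (simp add: algebra_simps binomial_eq_0)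
qed

lemma pent_1_rec: "pent x 1 (Suc (Suc n)) = pent x 1 (Suc n) - x ^ Suc n * pent x 0 n"
proof -
  \<comment> \<open>For \<open>2 * j > n\<close> the difference in the exponent is truncated, but the coefficient is zero.\<close>
  have "x ^ (Suc (j + 1) choose 2) * x ^ (n - j - j) * gauss x (n - j) j =
        x ^ Suc n * x ^ (j choose 2) * gauss x (n - j) j" for j
  proof (cases "2 * j \<le> n")
    case True
    then have "(Suc (j + 1) choose 2) + (n - j - j) = Suc n + (j choose 2)"
      by (simp add: Suc_choose_two)
    then show ?thesis
      by (simp only: power_add[symmetric])
  qed (simp add: gauss_eq_0)
  then have "(\<Sum>j\<le>n. (-1) ^ j * x ^ (Suc (j + 1) choose 2) * gauss x (Suc (n - j)) (Suc j)) =
        (\<Sum>j\<le>n. (-1) ^ j * x ^ (Suc (j + 1) choose 2) * gauss x (n - j) (Suc j)) +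
        x ^ Suc n * pent x 0 n"
    unfolding pent_def sum_distrib_left sum.distrib[symmetric]
    by (intro sum.cong) (simp_all add: gauss_Suc_Suc' algebra_simps del: gauss.simps(3) power_Suc)
  then show ?thesis
    unfolding pent_Suc_Suc[of x 1 n] pent_Suc[of x 1 n] by (simp add: algebra_simps)
qed

text \<open>
  By the first rule, \<open>F\<^bsub>n + 3\<^esub>\<close> is a difference of consecutive companion sums; by the second rule that
  difference is a multiple of \<open>F\<^sub>n\<close>.
\<close>

lemma pent_rec: "pent x 0 (n + 3) = - (x ^ Suc n * pent x 0 n)"
  using pent_0_rec[of x "Suc n"] pent_1_rec[of x n] by (simp add: numeral_3_eq_3)

lemma pent_3m: "pent x 0 (3 * m) = (-1) ^ m * x ^ (m * (3 * m - 1) div 2)"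
proof (induction m)
  case (Suc m)
  have "Suc m * (3 * Suc m - 1) = m * (3 * m - 1) + 2 * Suc (3 * m)"
    by (cases m) (simp_all add: algebra_simps)
  then have "Suc m * (3 * Suc m - 1) div 2 = m * (3 * m - 1) div 2 + Suc (3 * m)"
    by simp
  then show ?case
    using pent_rec[of x "3 * m"] Suc.IH
    by (simp only: power_add power_Suc) (simp add: algebra_simps)
qed (simp add: pent_def numeral_2_eq_2)

lemma pent_3m_1: "pent x 0 (3 * m + 1) = (-1) ^ m * x ^ (m * (3 * m + 1) div 2)"
proof (induction m)
  case (Suc m)
  have "Suc m * (3 * Suc m + 1) = m * (3 * m + 1) + 2 * Suc (3 * m + 1)"
    by (simp add: algebra_simps)
  then have "Suc m * (3 * Suc m + 1) div 2 = m * (3 * m + 1) div 2 + Suc (3 * m + 1)"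
    by simp
  then show ?case
    using pent_rec[of x "3 * m + 1"] Suc.IH
    by (simp only: power_add power_Suc) (simp add: algebra_simps)
qed (simp add: pent_def numeral_2_eq_2)

lemma pent_3m_2: "pent x 0 (3 * m + 2) = 0"
proof (induction m)
  case 0
  show ?case by (simp add: pent_def numeral_2_eq_2)
next
  case (Suc m)
  then show ?case
    using pent_rec[of x "3 * m + 2"] by (simp add: algebra_simps)
qed

section \<open>Congruences in a commutative ring\<close>

text \<open>
  Polynomials over \<open>\<int>\<close> admit no division with remainder, so congruence has to be
  expressed by divisibility of the difference.
\<close>

definition cong_mod :: "'a::comm_ring_1 \<Rightarrow> 'a \<Rightarrow> 'a \<Rightarrow> bool" where
  "cong_mod M a b \<longleftrightarrow> M dvd a - b"

lemma cong_mod_refl [simp]: "cong_mod M a a"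
  by (simp add: cong_mod_def)

lemma cong_mod_sym: "cong_mod M a b \<Longrightarrow> cong_mod M b a"
  unfolding cong_mod_def by (subst dvd_minus_iff[symmetric]) simp

lemma cong_mod_trans [trans]: "cong_mod M a b \<Longrightarrow> cong_mod M b c \<Longrightarrow> cong_mod M a c"
  unfolding cong_mod_def using dvd_add[of M "a - b" "b - c"] by simp

lemma cong_mod_add: "cong_mod M a b \<Longrightarrow> cong_mod M c d \<Longrightarrow> cong_mod M (a + c) (b + d)"
  unfolding cong_mod_def using dvd_add[of M "a - b" "c - d"] by (simp add: algebra_simps)

lemma cong_mod_mult:
  assumes "cong_mod M a b" "cong_mod M c d"
  shows "cong_mod M (a * c) (b * d)"
proof -
  have "a * c - b * d = a * (c - d) + (a - b) * d"
    by (simp add: algebra_simps)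
  then show ?thesis
    using assms unfolding cong_mod_def by simp
qed

lemma cong_mod_power: "cong_mod M a b \<Longrightarrow> cong_mod M (a ^ k) (b ^ k)"
  by (induction k) (simp_all add: cong_mod_mult)

lemma cong_mod_sum: "(\<And>i. i \<in> A \<Longrightarrow> cong_mod M (f i) (g i)) \<Longrightarrow> cong_mod M (sum f A) (sum g A)"
  by (induction A rule: infinite_finite_induct) (simp_all add: cong_mod_add)

lemma cong_mod_prod: "(\<And>i. i \<in> A \<Longrightarrow> cong_mod M (f i) (g i)) \<Longrightarrow> cong_mod M (prod f A) (prod g A)"
  by (induction A rule: infinite_finite_induct) (simp_all add: cong_mod_mult)

section \<open>The summands modulo the square of a cyclotomic modulus\<close>

text \<open>
  The properties of \<open>x = q\<close> and \<open>P = \<Phi>\<^sub>n(q)\<close> on which the congruences rest;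
  the factors that may be cancelled are those that do not vanish at the primitive \<open>n\<close>th roots of unity.
\<close>

locale cyclotomic_modulus =
  fixes x P :: "'a::idom" and n :: nat
  assumes n_pos: "n > 0"
    and not_root_of_unity: "i > 0 \<Longrightarrow> x ^ i \<noteq> 1"
    and dvd_P: "P dvd 1 - x ^ n"
    and cancel: "\<not> n dvd i \<Longrightarrow> P\<^sup>2 dvd (1 - x ^ i) * a \<Longrightarrow> P\<^sup>2 dvd a"
    and cancel_2: "P\<^sup>2 dvd 2 * a \<Longrightarrow> P\<^sup>2 dvd a"
begin

abbreviation cong1 (infix "\<simeq>\<^sub>1" 50) where "a \<simeq>\<^sub>1 b \<equiv> cong_mod P a b"
abbreviation cong2 (infix "\<simeq>\<^sub>2" 50) where "a \<simeq>\<^sub>2 b \<equiv> cong_mod (P\<^sup>2) a b"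

lemma power_n: "x ^ n \<simeq>\<^sub>1 1"
  using dvd_P cong_mod_sym[of P 1 "x ^ n"] by (simp add: cong_mod_def)

lemma square_cong_0: "(1 - x ^ n) * (1 - x ^ n) \<simeq>\<^sub>2 0"
  using mult_dvd_mono[OF dvd_P dvd_P] by (simp add: cong_mod_def power2_eq_square)

text \<open>
  A factor \<open>1 - x\<^sup>n\<close> raises a congruence modulo \<open>P\<close> to one modulo \<open>P\<^sup>2\<close>; hence in the summands with
  \<open>k \<ge> 1\<close> the power \<open>x\<^sup>n\<close> may be replaced by \<open>1\<close> in the cofactor.
\<close>

lemma lift_cong: "a \<simeq>\<^sub>1 b \<Longrightarrow> (1 - x ^ n) * a \<simeq>\<^sub>2 (1 - x ^ n) * b"
  using mult_dvd_mono[OF dvd_P, of P "a - b"]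
  by (simp add: cong_mod_def power2_eq_square flip: right_diff_distrib)

lemma cancel_qpoch:
  assumes "qpoch x a k * b \<simeq>\<^sub>2 qpoch x a k * c" "\<And>i. 1 \<le> i \<Longrightarrow> i \<le> k \<Longrightarrow> \<not> n dvd a + i"
  shows "b \<simeq>\<^sub>2 c"
  using assms
proof (induction k)
  case (Suc k)
  have "P\<^sup>2 dvd (1 - x ^ (a + Suc k)) * (qpoch x a k * b - qpoch x a k * c)"
    using Suc.prems(1) by (simp add: cong_mod_def qpoch_Suc algebra_simps)
  then have "qpoch x a k * b \<simeq>\<^sub>2 qpoch x a k * c"
    unfolding cong_mod_def by (rule cancel[rotated]) (rule Suc.prems(2), simp_all)
  then show ?case
    by (rule Suc.IH) (use Suc.prems(2) in simp)
qed simp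

lemma qpoch_nonzero: "qpoch x 0 k \<noteq> 0"
  using not_root_of_unity by (auto simp: qpoch_def)

lemma qpoch_n: "qpoch x n k \<simeq>\<^sub>1 qpoch x 0 k"
  unfolding qpoch_def
proof (rule cong_mod_prod)
  fix i
  have "(1 - x ^ (n + i)) - (1 - x ^ (0 + i)) = (1 - x ^ n) * x ^ i"
    by (simp add: power_add algebra_simps)
  then show "1 - x ^ (n + i) \<simeq>\<^sub>1 1 - x ^ (0 + i)"
    using dvd_P by (simp add: cong_mod_def)
qed

text \<open>The two factors with exponents \<open>n\<close> and \<open>2n\<close> stand apart: one cancels, the other one remains.\<close>

lemma qpoch_2n: "qpoch x 0 (2 * n) =
  qpoch x 0 (n - 1) * (1 - x ^ n) * qpoch x n (n - 1) * ((1 - x ^ n) * (1 + x ^ n))"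
proof -
  obtain l where l: "n = Suc l" using n_pos by (cases n) auto
  have "x ^ (n + n) = x ^ n * x ^ n" by (rule power_add)
  then have "(1 - x ^ n) * (1 + x ^ n) = 1 - x ^ (n + n)"
    by (simp add: algebra_simps)
  then show ?thesis
    using qpoch_add[of x 0 n n] qpoch_Suc[of x 0 l] qpoch_Suc[of x n l]
    by (simp add: l mult_2 mult.assoc del: power_Suc)
qed

lemma qpoch_n_n:
  "qpoch x 0 n = qpoch x 0 (n - 1) * (1 - x ^ n)"
  using n_pos by (cases n) (simp_all add: qpoch_Suc)

text \<open>
  The product of \<open>x\<^sup>i (1 - x\<^bsup>n - i\<^esup>) \<equiv> - (1 - x\<^sup>i)\<close> over \<open>1 \<le> i \<le> k\<close>; the powers \<open>x\<^sup>i\<close> collect to the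
  triangular exponent on the left.
\<close>

lemma reflect:
  "k < n \<Longrightarrow> x ^ (Suc k choose 2) * qpoch x (n - Suc k) k \<simeq>\<^sub>1 (-1) ^ k * qpoch x 0 k"
proof (induction k)
  case (Suc k)
  define d where "d = n - Suc (Suc k)"
  have n: "n = d + Suc (Suc k)" using Suc.prems by (simp add: d_def)
  have "x ^ (Suc (Suc k) choose 2) * qpoch x d (Suc k) =
          (x ^ Suc k * (1 - x ^ Suc d)) * (x ^ (Suc k choose 2) * qpoch x (Suc d) k)"
    unfolding Suc_choose_two[of "Suc k"] power_add qpoch_Suc' by (simp add: mult_ac)
  also have "\<dots> \<simeq>\<^sub>1 (- (1 - x ^ Suc k)) * ((-1) ^ k * qpoch x 0 k)"
  proof (rule cong_mod_mult)
    have "x ^ n = x ^ Suc k * x ^ Suc d"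
      unfolding n power_add[symmetric] by (simp add: add_ac del: power_Suc)
    then have eq: "x ^ Suc k * (1 - x ^ Suc d) - (- (1 - x ^ Suc k)) = 1 - x ^ n"
      by (simp add: algebra_simps)
    show "x ^ Suc k * (1 - x ^ Suc d) \<simeq>\<^sub>1 - (1 - x ^ Suc k)"
      unfolding cong_mod_def eq by (rule dvd_P)
    show "x ^ (Suc k choose 2) * qpoch x (Suc d) k \<simeq>\<^sub>1 (-1) ^ k * qpoch x 0 k"
      using Suc by (simp add: n)
  qed
  also have "\<dots> = (-1) ^ Suc k * qpoch x 0 (Suc k)"
    by (simp add: qpoch_Suc algebra_simps)
  finally show ?case by (simp add: d_def)
qed (simp add: binomial_eq_0)

text \<open>
  Both sides, multiplied by \<open>(x)\<^sub>k (x)\<^bsub>n - 2k\<^esub> (1 - x\<^bsup>n + 1\<^esup>) \<dots> (1 - x\<^bsup>n + k\<^esup>)\<close>, become \<open>1 - x\<^sup>n\<close> times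
  expressions that agree modulo \<open>P\<close>. The hypothesis on \<open>V\<close> says without division that
  \<open>V = (1 - x\<^sup>n) / (1 - x\<^bsup>n - k\<^esup>) [n - k; k]\<close>.
\<close>

lemma term_cong:
  assumes k: "1 \<le> k" "2 * k \<le> n"
    and V: "V * qpoch x 0 k * qpoch x 0 (n - 2 * k) = (1 - x ^ n) * qpoch x 0 (n - Suc k)"
  shows "x ^ (k * (k + n)) * gauss x (2 * n) k * gauss x (2 * n - k) (k + n) \<simeq>\<^sub>2
         2 * ((-1) ^ k * x ^ (k choose 2) * V)" (is "?T \<simeq>\<^sub>2 2 * ?U")
proof -
  let ?D = "qpoch x 0"
  let ?y = "1 - x ^ n"
  \<comment> \<open>Writing the summand as a quotient of factorials, and removing the common factor \<open>1 - x\<^sup>n\<close>.\<close>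
  have "gauss x (2 * n) k * ?D k * (gauss x (2 * n - k) (k + n) * ?D (k + n) * ?D (n - 2 * k)) = ?D (2 * n)"
    using gauss_mult_qpoch[of k "2 * n" x] gauss_mult_qpoch[of "k + n" "2 * n - k" x] k
    by (simp add: mult_2)
  moreover have "?D (k + n) = ?D (n - 1) * ?y * qpoch x n k"
    using qpoch_add[of x 0 n k] qpoch_n_n by (simp add: add.commute)
  ultimately have D2n: "gauss x (2 * n) k * ?D k * (gauss x (2 * n - k) (k + n) *
      (?D (n - 1) * ?y * qpoch x n k) * ?D (n - 2 * k)) = ?D (2 * n)"
    by simp
  have "(?D (n - 1) * ?y) * (?T * ?D k * ?D (n - 2 * k) * qpoch x n k) = x ^ (k * (k + n)) * ?D (2 * n)"
    unfolding D2n[symmetric] by (simp only: mult_ac)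
  also have "\<dots> = (?D (n - 1) * ?y) * (?y * (x ^ (k * (k + n)) * (1 + x ^ n) * qpoch x n (n - 1)))"
    unfolding qpoch_2n by (simp only: mult_ac)
  finally have "?T * ?D k * ?D (n - 2 * k) * qpoch x n k =
     ?y * (x ^ (k * (k + n)) * (1 + x ^ n) * qpoch x n (n - 1))"
    by (rule mult_left_cancel[THEN iffD1, rotated])
       (use qpoch_nonzero[of "n - 1"] not_root_of_unity[OF n_pos] in simp)
  also have "\<dots> \<simeq>\<^sub>2 ?y * (x ^ (k * k) * 2 * ?D (n - 1))"
  proof (intro lift_cong cong_mod_mult qpoch_n)
    have "x ^ (k * (k + n)) = x ^ (k * k) * (x ^ n) ^ k"
      by (simp add: power_add power_mult[symmetric] algebra_simps)
    then show "x ^ (k * (k + n)) \<simeq>\<^sub>1 x ^ (k * k)"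
      using cong_mod_mult[OF cong_mod_refl cong_mod_power[OF power_n, of k], of "x ^ (k * k)"] by simp
    show "1 + x ^ n \<simeq>\<^sub>1 2"
      using cong_mod_add[OF cong_mod_refl power_n, of 1] by simp
  qed
  \<comment> \<open>Splitting \<open>k\<^sup>2\<close> into two consecutive triangular numbers prepares the reflection of the last
     \<open>k\<close> factors of \<open>?D (n - 1)\<close>.\<close>
  also have "\<dots> = ?y * (2 * x ^ (k choose 2) * ?D (n - Suc k) *
                 (x ^ (Suc k choose 2) * qpoch x (n - Suc k) k))"
  proof -
    have "k * k = (k choose 2) + (Suc k choose 2)"
      by (induction k) (simp_all add: Suc_choose_two)
    moreover have "?D (n - 1) = ?D (n - Suc k) * qpoch x (n - Suc k) k"
      using qpoch_add[of x 0 "n - Suc k" k] k by simp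
    ultimately show ?thesis
      by (simp only: power_add) (simp add: mult_ac)
  qed
  also have "\<dots> \<simeq>\<^sub>2 ?y * (2 * x ^ (k choose 2) * ?D (n - Suc k) * ((-1) ^ k * qpoch x n k))"
    by (rule lift_cong, rule cong_mod_mult[OF cong_mod_refl],
        rule cong_mod_trans[OF reflect],
        use k in simp, rule cong_mod_mult[OF cong_mod_refl cong_mod_sym[OF qpoch_n]])
  also have "\<dots> = 2 * ?U * ?D k * ?D (n - 2 * k) * qpoch x n k"
  proof -
    have "2 * ?U * ?D k * ?D (n - 2 * k) * qpoch x n k =
        2 * ((-1) ^ k * x ^ (k choose 2)) * qpoch x n k * (V * ?D k * ?D (n - 2 * k))"
      by (simp add: mult_ac)
    then show ?thesis unfolding V by (simp only: mult_ac)
  qed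
  finally have "?D k * (?D (n - 2 * k) * (qpoch x n k * ?T)) \<simeq>\<^sub>2
        ?D k * (?D (n - 2 * k) * (qpoch x n k * (2 * ?U)))"
    by (simp add: mult_ac)
  then have "?D (n - 2 * k) * (qpoch x n k * ?T) \<simeq>\<^sub>2 ?D (n - 2 * k) * (qpoch x n k * (2 * ?U))"
    by (rule cancel_qpoch) (rule nat_dvd_not_less, use k in simp_all)
  then have "qpoch x n k * ?T \<simeq>\<^sub>2 qpoch x n k * (2 * ?U)"
    by (rule cancel_qpoch) (rule nat_dvd_not_less, use k in simp_all)
  then show ?thesis
    by (rule cancel_qpoch) (subst dvd_add_right_iff, simp, rule nat_dvd_not_less, use k in simp_all)
qed

text \<open>
  Put \<open>y = 1 - x\<^sup>n\<close>, \<open>D = (x)\<^bsub>n - 1\<^esub>\<close> and \<open>E = (1 - x\<^bsup>n + 1\<^esup>) \<dots> (1 - x\<^bsup>2n - 1\<^esup>)\<close>, so that \<open>[2n; n] D = (2 - y) E\<close>.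
  Expanding \<open>E\<close> to first order in \<open>y\<close> would bring in the sum of all \<open>x\<^sup>i / (1 - x\<^sup>i)\<close>. Squaring avoids it:
  pairing the factors \<open>i\<close> and \<open>n - i\<close> in \<open>E\<^sup>2\<close> gives \<open>E\<^sup>2 \<equiv> (x\<^sup>n)\<^bsup>n - 1\<^esup> D\<^sup>2 \<equiv> (1 - (n - 1) y) D\<^sup>2\<close> modulo \<open>P\<^sup>2\<close>.
  As \<open>E \<equiv> D\<close> modulo \<open>P\<close>, the square of \<open>E - D\<close> vanishes modulo \<open>P\<^sup>2\<close>, so \<open>E\<^sup>2 \<equiv> 2 D E - D\<^sup>2\<close> and the
  relation becomes linear in \<open>E\<close>. The price is a factor \<open>2\<close> to be cancelled.
\<close>

lemma central_cong: "gauss x (2 * n) n \<simeq>\<^sub>2 2 - of_nat n * (1 - x ^ n)" (is "?C \<simeq>\<^sub>2 _")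
proof -
  define y where "y = 1 - x ^ n"
  define D where "D = qpoch x 0 (n - 1)"
  define E where "E = qpoch x n (n - 1)"
  have xn: "x ^ n = 1 - y" by (simp add: y_def)
  have yy: "P\<^sup>2 dvd y * y" using square_cong_0 by (simp add: cong_mod_def y_def)
  have "?C * (D * y) * (D * y) = D * y * E * (y * (1 + x ^ n))"
    using gauss_mult_qpoch[of n "2 * n" x] qpoch_2n qpoch_n_n by (simp add: y_def D_def E_def)
  then have "(D * y) * y * (?C * D) = (D * y) * y * ((1 + x ^ n) * E)"
    by (simp add: mult_ac)
  then have C: "?C * D = (2 - y) * E"
    using qpoch_nonzero[of "n - 1"] not_root_of_unity[OF n_pos] by (simp add: D_def y_def)
  have rev: "(\<Prod>i=1..n-1. f i) = (\<Prod>i=1..n-1. f (n - i))" for f :: "nat \<Rightarrow> 'a"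
    by (rule prod.reindex_bij_witness[of _ "\<lambda>i. n - i" "\<lambda>i. n - i"]) auto
  have pair: "(1 - c * a) * (1 - c * b) - c * ((1 - a) * (1 - b)) = (1 - c) * (1 - c) * (1 + c)"
    if "a * b = c" for a b c :: 'a
    unfolding that[symmetric] by (simp add: algebra_simps)
  have "E * E = (\<Prod>i=1..n-1. (1 - x ^ (n + i)) * (1 - x ^ (n + (n - i))))"
    unfolding E_def qpoch_def prod.distrib using rev[of "\<lambda>i. 1 - x ^ (n + i)"] by simp
  also have "\<dots> \<simeq>\<^sub>2 (\<Prod>i=1..n-1. x ^ n * ((1 - x ^ i) * (1 - x ^ (n - i))))"
  proof (rule cong_mod_prod)
    fix i assume "i \<in> {1..n-1}"
    then have "i + (n - i) = n"
      by auto
    then have "x ^ i * x ^ (n - i) = x ^ n"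
      by (metis power_add)
    then have "(1 - x ^ (n + i)) * (1 - x ^ (n + (n - i))) - x ^ n * ((1 - x ^ i) * (1 - x ^ (n - i)))
       = y * y * (1 + x ^ n)"
      unfolding power_add y_def by (rule pair)
    then show "(1 - x ^ (n + i)) * (1 - x ^ (n + (n - i))) \<simeq>\<^sub>2 x ^ n * ((1 - x ^ i) * (1 - x ^ (n - i)))"
      using yy by (simp add: cong_mod_def)
  qed
  also have "\<dots> = (x ^ n) ^ (n - 1) * (D * D)"
    unfolding D_def qpoch_def prod.distrib using rev[of "\<lambda>i. 1 - x ^ i"] by simp
  also have "\<dots> \<simeq>\<^sub>2 (1 - of_nat (n - 1) * y) * (D * D)"
  proof (rule cong_mod_mult[OF _ cong_mod_refl])
    show "(x ^ n) ^ k \<simeq>\<^sub>2 1 - of_nat k * y" for k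
    proof (induction k)
      case (Suc k)
      have "(x ^ n) ^ Suc k \<simeq>\<^sub>2 (1 - y) * (1 - of_nat k * y)"
        unfolding power_Suc xn[symmetric] by (rule cong_mod_mult[OF cong_mod_refl Suc.IH])
      also have "\<dots> \<simeq>\<^sub>2 1 - of_nat (Suc k) * y"
      proof -
        have "(1 - y) * (1 - of_nat k * y) - (1 - of_nat (Suc k) * y) = y * y * of_nat k"
          by (simp add: algebra_simps)
        then show ?thesis using yy by (simp add: cong_mod_def)
      qed
      finally show ?case .
    qed simp
  qed
  finally have EE: "P\<^sup>2 dvd E * E - (1 - of_nat (n - 1) * y) * (D * D)"
    by (simp add: cong_mod_def)
  have "P dvd E - D"
    using qpoch_n by (simp add: cong_mod_def E_def D_def)
  then have ED: "P\<^sup>2 dvd (E - D) * (E - D)"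
    using mult_dvd_mono[of P "E - D" P "E - D"] by (simp add: power2_eq_square)
  have on: "of_nat n = (1 + of_nat (n - 1) :: 'a)"
    using n_pos by (cases n) simp_all
  have expand: "(2 - y) * (E * E - (1 - c * y) * (D * D)) - (2 - y) * ((E - D) * (E - D)) + D * D * c * (y * y) =
      D * (2 * ((2 - y) * E - (2 - (1 + c) * y) * D))" for c y E D :: 'a
    by algebra
  have factor: "D * (2 * (C * D - c * D)) = D * (D * (2 * (C - c)))" for C D c :: 'a
    by algebra
  have "P\<^sup>2 dvd (2 - y) * (E * E - (1 - of_nat (n - 1) * y) * (D * D)) - (2 - y) * ((E - D) * (E - D))
       + D * D * of_nat (n - 1) * (y * y)"
    by (rule dvd_add[OF dvd_diff[OF dvd_mult[OF EE] dvd_mult[OF ED]] dvd_mult[OF yy]])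
  also have "\<dots> = D * (2 * ((2 - y) * E - (2 - of_nat n * y) * D))"
    unfolding on by (rule expand)
  also have "\<dots> = D * (D * (2 * (?C - (2 - of_nat n * y))))"
    unfolding C[symmetric] by (rule factor)
  finally have "D * (D * (2 * (?C - (2 - of_nat n * y)))) \<simeq>\<^sub>2 D * (D * 0)"
    by (simp add: cong_mod_def)
  then have "D * (2 * (?C - (2 - of_nat n * y))) \<simeq>\<^sub>2 D * 0"
    unfolding D_def by (rule cancel_qpoch) (rule nat_dvd_not_less, use n_pos in simp_all)
  then have "2 * (?C - (2 - of_nat n * y)) \<simeq>\<^sub>2 0"
    unfolding D_def by (rule cancel_qpoch) (rule nat_dvd_not_less, use n_pos in simp_all)
  then show ?thesis
    unfolding cong_mod_def y_def diff_0_right by (rule cancel_2)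
qed

section \<open>Evaluation of the sum\<close>

definition trinom :: 'a where
  "trinom = (\<Sum>k\<le>2 * n. x ^ (k * (k + n)) * gauss x (2 * n) k * gauss x (2 * n - k) (k + n))"

text \<open>
  With \<open>V j\<close> in the role of \<open>V\<^bsub>j + 1\<^esub>\<close>, the summands for \<open>k = j + 1\<close> add up to the difference of two
  alternating sums: up to sign, the first part of \<open>V j\<close> gives \<open>F\<^sub>n\<close> without its leading term, the second part
  gives \<open>F\<^bsub>n - 2\<^esub>\<close>.
\<close>

lemma trinom_cong:
  assumes "n = Suc (Suc l)"
  shows "trinom \<simeq>\<^sub>2 2 * (pent x 0 n - x ^ Suc l * pent x 0 l) - of_nat n * (1 - x ^ n)"
proof -
  define V where "V j = gauss x (Suc (l - j)) (Suc j) + x ^ (Suc l - j) * gauss x (l - j) j" for j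
  define T where "T k = x ^ (k * (k + n)) * gauss x (2 * n) k * gauss x (2 * n - k) (k + n)" for k
  have "trinom = T 0 + (\<Sum>j\<le>Suc (2 * l + 2). T (Suc j))"
    unfolding trinom_def T_def[symmetric]
    by (simp add: assms sum.atMost_Suc_shift del: sum.atMost_Suc)
  also have "(\<Sum>j\<le>Suc (2 * l + 2). T (Suc j)) = (\<Sum>j\<le>l. T (Suc j))"
    by (rule sum.mono_neutral_right) (auto simp: T_def assms gauss_eq_0 simp del: gauss.simps)
  also have "T 0 + (\<Sum>j\<le>l. T (Suc j)) \<simeq>\<^sub>2 (2 - of_nat n * (1 - x ^ n)) +
     (\<Sum>j\<le>l. 2 * ((-1) ^ Suc j * x ^ (Suc j choose 2) * V j))"
  proof (intro cong_mod_add cong_mod_sum)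
    show "T 0 \<simeq>\<^sub>2 2 - of_nat n * (1 - x ^ n)"
      using central_cong by (simp add: T_def)
    fix j
    show "T (Suc j) \<simeq>\<^sub>2 2 * ((-1) ^ Suc j * x ^ (Suc j choose 2) * V j)"
    proof (cases "2 * j \<le> l")
      case True
      then obtain d where l: "l = j + j + d"
        using le_iff_add[of "2 * j" l] by auto
      show ?thesis
        unfolding T_def
      proof (rule term_cong)
        have 1: "gauss x (Suc (j + d)) (Suc j) * qpoch x 0 (Suc j) * qpoch x 0 d = qpoch x 0 (Suc (j + d))"
          using gauss_mult_qpoch[of "Suc j" "Suc (j + d)" x] by simp
        have 2: "gauss x (j + d) j * qpoch x 0 j * qpoch x 0 d = qpoch x 0 (j + d)"
          using gauss_mult_qpoch[of j "j + d" x] by simp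
        have "V j * qpoch x 0 (Suc j) * qpoch x 0 d =
           gauss x (Suc (j + d)) (Suc j) * qpoch x 0 (Suc j) * qpoch x 0 d +
           x ^ Suc (j + d) * (1 - x ^ Suc j) * (gauss x (j + d) j * qpoch x 0 j * qpoch x 0 d)"
          by (simp add: V_def l qpoch_Suc algebra_simps del: gauss.simps power_Suc)
        also have "\<dots> = (1 - x ^ (Suc (j + d) + Suc j)) * qpoch x 0 (j + d)"
          unfolding 1 2 power_add[of x "Suc (j + d)" "Suc j"]
          by (simp add: qpoch_Suc algebra_simps del: power_Suc)
        finally show "V j * qpoch x 0 (Suc j) * qpoch x 0 (n - 2 * Suc j) =
             (1 - x ^ n) * qpoch x 0 (n - Suc (Suc j))"
          by (simp add: assms l add_ac del: power_Suc)
      qed (use True assms in simp_all)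
    next
      \<comment> \<open>Beyond the middle both sides are zero.\<close>
      case False
      then show ?thesis
        by (simp add: T_def V_def assms gauss_eq_0 del: gauss.simps)
    qed
  qed
  also have "\<dots> = 2 * (pent x 0 n - x ^ Suc l * pent x 0 l) - of_nat n * (1 - x ^ n)"
  proof -
    have "x ^ Suc l * pent x 0 l = (\<Sum>j\<le>l. (-1) ^ j * x ^ (Suc j choose 2) *
        (x ^ (Suc l - j) * gauss x (l - j) j))"
      unfolding pent_def sum_distrib_left
    proof (rule sum.cong[OF refl])
      fix j assume "j \<in> {..l}"
      then have "x ^ Suc l = x ^ j * x ^ (Suc l - j)"
        by (simp flip: power_add power_Suc)
      then show "x ^ Suc l * ((-1) ^ j * x ^ (j + 0 choose 2) * gauss x (l - j) j) =
        (-1) ^ j * x ^ (Suc j choose 2) * (x ^ (Suc l - j) * gauss x (l - j) j)"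
        by (simp only: Suc_choose_two power_add add_0_right mult_ac)
    qed
    then have "pent x 0 n - x ^ Suc l * pent x 0 l =
       1 - (\<Sum>j\<le>l. (-1) ^ j * x ^ (Suc j choose 2) * V j)"
      unfolding assms pent_Suc_Suc V_def distrib_left sum.distrib
      by (simp add: numeral_2_eq_2 algebra_simps del: gauss.simps power_Suc)
    moreover have "(\<Sum>j\<le>l. 2 * ((-1) ^ Suc j * x ^ (Suc j choose 2) * V j)) =
        - 2 * (\<Sum>j\<le>l. (-1) ^ j * x ^ (Suc j choose 2) * V j)"
      unfolding sum_distrib_left by (rule sum.cong) (simp_all add: mult_ac)
    ultimately show ?thesis
      by (simp only:) (simp add: algebra_simps)
  qed
  finally show ?thesis .
qed

lemma trinom_cong_1:
  assumes "n = 1"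
  shows "trinom \<simeq>\<^sub>2 2 - of_nat n * (1 - x ^ n)"
proof -
  have "trinom = gauss x (2 * n) n"
    unfolding trinom_def by (simp add: assms numeral_2_eq_2)
  then show ?thesis
    using central_cong by simp
qed

text \<open>
  Both \<open>F\<^sub>n\<close> and \<open>F\<^bsub>n - 2\<^esub>\<close> contribute; their exponents differ by \<open>m\<close> once the factor \<open>x\<^bsup>n - 1\<^esup>\<close> is
  included.
\<close>

lemma trinom_cong_3m:
  assumes n: "n = 3 * m"
  shows "trinom \<simeq>\<^sub>2 2 * (-1) ^ m * (1 + x ^ m) * x ^ (m * (3 * m - 1) div 2) - of_nat n * (1 - x ^ n)"
proof -
  obtain l where m: "m = Suc l"
    using n n_pos by (cases m) auto
  have n': "n = Suc (Suc (3 * l + 1))"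
    using n m by simp
  have "2 * m + m * (3 * m - 1) = 2 * Suc (3 * l + 1) + l * (3 * l + 1)"
    by (simp add: m algebra_simps)
  then have "Suc (3 * l + 1) + l * (3 * l + 1) div 2 = m + m * (3 * m - 1) div 2"
    by simp
  then have powers: "x ^ Suc (3 * l + 1) * x ^ (l * (3 * l + 1) div 2) = x ^ m * x ^ (m * (3 * m - 1) div 2)"
    by (simp only: power_add[symmetric])
  have sign: "(-1) ^ l = - ((-1) ^ m :: 'a)"
    by (simp add: m)
  have "x ^ Suc (3 * l + 1) * pent x 0 (3 * l + 1) = - ((-1) ^ m * (x ^ m * x ^ (m * (3 * m - 1) div 2)))"
    unfolding pent_3m_1 sign mult.left_commute[of "x ^ Suc (3 * l + 1)"] powers by simp
  moreover have "pent x 0 n = (-1) ^ m * x ^ (m * (3 * m - 1) div 2)"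
    unfolding n by (rule pent_3m)
  ultimately have "2 * (pent x 0 n - x ^ Suc (3 * l + 1) * pent x 0 (3 * l + 1)) =
      2 * (-1) ^ m * (1 + x ^ m) * x ^ (m * (3 * m - 1) div 2)"
    by (simp only:) (simp add: algebra_simps)
  then show ?thesis
    using trinom_cong[OF n'] by (simp only:)
qed

text \<open>For \<open>m > 0\<close> the sum \<open>F\<^bsub>n - 2\<^esub>\<close> vanishes, as \<open>n - 2\<close> is \<open>2\<close> modulo \<open>3\<close>.\<close>

lemma trinom_cong_3m_plus_1:
  assumes n: "n = 3 * m + 1"
  shows "trinom \<simeq>\<^sub>2 2 * (-1) ^ m * x ^ (m * (3 * m + 1) div 2) - of_nat n * (1 - x ^ n)"
proof (cases m)
  case 0
  then show ?thesis
    using trinom_cong_1 n by simp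
next
  case (Suc l)
  then have n': "n = Suc (Suc (3 * l + 2))"
    using n by simp
  have "pent x 0 n = (-1) ^ m * x ^ (m * (3 * m + 1) div 2)"
    unfolding n by (rule pent_3m_1)
  then show ?thesis
    using trinom_cong[OF n'] by (simp only: pent_3m_2 mult_zero_right diff_0_right mult.assoc)
qed

text \<open>Here it is \<open>F\<^sub>n\<close> that vanishes, and the value comes from \<open>F\<^bsub>n - 2\<^esub>\<close>.\<close>

lemma trinom_cong_3m_minus_1:
  assumes n: "n = 3 * m - 1"
  shows "trinom \<simeq>\<^sub>2 2 * (-1) ^ m * x ^ (m * (3 * m - 1) div 2) - of_nat n * (1 - x ^ n)"
proof -
  obtain l where m: "m = Suc l"
    using n n_pos by (cases m) auto
  have n': "n = Suc (Suc (3 * l))" "n = 3 * l + 2"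
    using n m by simp_all
  have "m * (3 * m - 1) = 2 * Suc (3 * l) + l * (3 * l - 1)"
    unfolding m by (cases l) (simp_all add: algebra_simps)
  then have "Suc (3 * l) + l * (3 * l - 1) div 2 = m * (3 * m - 1) div 2"
    by simp
  then have powers: "x ^ Suc (3 * l) * x ^ (l * (3 * l - 1) div 2) = x ^ (m * (3 * m - 1) div 2)"
    by (simp only: power_add[symmetric])
  have sign: "(-1) ^ l = - ((-1) ^ m :: 'a)"
    by (simp add: m)
  have "x ^ Suc (3 * l) * pent x 0 (3 * l) = - ((-1) ^ m * x ^ (m * (3 * m - 1) div 2))"
    unfolding pent_3m sign mult.left_commute[of "x ^ Suc (3 * l)"] powers by simp
  moreover have "pent x 0 n = 0"
    unfolding n'(2) by (rule pent_3m_2)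
  ultimately have "2 * (pent x 0 n - x ^ Suc (3 * l) * pent x 0 (3 * l)) =
      2 * (-1) ^ m * x ^ (m * (3 * m - 1) div 2)"
    by (simp only:) simp
  then show ?thesis
    using trinom_cong[OF n'(1)] by (simp only:)
qed

end

section \<open>Cyclotomic polynomials as moduli\<close>

lemma q_power_neq_1: "i > 0 \<Longrightarrow> q ^ i \<noteq> 1"
proof
  assume "i > 0" "q ^ i = 1"
  then have "poly (q ^ i) 2 = poly 1 2" by simp
  with \<open>i > 0\<close> show False by (simp add: poly_power)
qed

lemma qbinom_eq_gauss: "qbinom n (int k) = gauss q n k"
proof (cases "k \<le> n")
  case True
  have nz: "qpoch q 0 l \<noteq> 0" for l
    using q_power_neq_1 by (auto simp: qpoch_def)
  have "(\<Prod>i=1..k. 1 - q ^ (n - i + 1)) = qpoch q (n - k) k"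
    unfolding qpoch_def
    by (rule prod.reindex_bij_witness[of _ "\<lambda>i. k + 1 - i" "\<lambda>i. k + 1 - i"])
       (use True in \<open>auto simp: Suc_diff_le\<close>)
  then have "qbinom n (int k) * qpoch q 0 k = qpoch q (n - k) k"
    using qbinom_exact[of "int k" n] True by (simp add: qpoch_def)
  then have "(qpoch q 0 k * qpoch q 0 (n - k)) * qbinom n (int k) = qpoch q 0 n"
    using qpoch_add[of q 0 "n - k" k] True by (simp add: mult_ac)
  also have "\<dots> = (qpoch q 0 k * qpoch q 0 (n - k)) * gauss q n k"
    using gauss_mult_qpoch[OF True, of q] by (simp add: mult_ac)
  finally show ?thesis
    using nz by (metis mult_cancel_left mult_eq_0_iff)
qed (simp add: qbinom_def gauss_eq_0)

lemma lead_coeff_cyclotomic: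
  assumes "n > 0"
  shows "lead_coeff (cyclotomic n) = 1"
  using of_int_cyclotomic_exists[OF assms] of_int_cyclotomic[OF assms] map_poly_of_int_inj by metis

text \<open>The quotient by a monic polynomial needs no denominators, so divisibility descends from \<open>\<complex>[q]\<close>.\<close>

lemma monic_dvd_of_int:
  assumes "lead_coeff p = 1" "map_poly of_int p dvd (map_poly of_int a :: complex poly)"
  shows "p dvd a"
proof -
  obtain g :: "complex poly" where g: "map_poly of_int a = map_poly of_int p * g"
    using assms(2) by blast
  obtain h where "g = map_poly of_int h"
    using monic_quotient_of_int[OF g assms(1)] by blast
  then have "map_poly of_int a = (map_poly of_int (p * h) :: complex poly)"
    using g by (simp add: map_poly_of_int_mult)
  then have "a = p * h" using map_poly_of_int_inj by blast
  then show ?thesis by simp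
qed

lemma map_poly_one_minus_q_power:
  "map_poly of_int (1 - q ^ i) = (1 - monom 1 i :: complex poly)"
proof -
  have "q ^ i = monom 1 i" by (simp add: monom_altdef)
  then show ?thesis by (intro poly_eqI) (simp add: coeff_map_poly)
qed

lemma cyclotomic_dvd:
  assumes "n > 0"
  shows "cyclotomic n dvd 1 - q ^ n"
proof (rule monic_dvd_of_int)
  have "cyclotomic_complex n dvd (\<Prod>d | d dvd n. cyclotomic_complex d)"
    using assms by (intro dvd_prodI) auto
  then have "cyclotomic_complex n dvd - (monom 1 n - 1)"
    unfolding prod_cyclotomic_complex[OF assms] dvd_minus_iff .
  then show "map_poly of_int (cyclotomic n) dvd (map_poly of_int (1 - q ^ n) :: complex poly)"
    unfolding of_int_cyclotomic[OF assms] map_poly_one_minus_q_power by simp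
qed (rule lead_coeff_cyclotomic[OF assms])

lemma coprime_linear:
  fixes p :: "'a::field_gcd poly"
  assumes "poly p z \<noteq> 0"
  shows "coprime [:- z, 1:] p"
proof -
  have "prime_elem [:- z, 1:]" by (rule prime_elem_linear_poly) auto
  then show ?thesis
    using assms by (metis poly_eq_0_iff_dvd prime_elem_imp_coprime)
qed

text \<open>A primitive \<open>n\<close>th root of unity satisfies \<open>z\<^sup>i = 1\<close> only if \<open>n\<close> divides \<open>i\<close>.\<close>

lemma coprime_cyclotomic_complex:
  assumes "n > 0" "\<not> n dvd i"
  shows "coprime (cyclotomic_complex n) (1 - monom 1 i)"
  unfolding cyclotomic_complex_altdef
proof (rule prod_coprime_left)
  fix k assume "k \<in> {k. 1 \<le> k \<and> k \<le> n \<and> gcd n k = 1}"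
  then have co: "coprime n k" by (simp add: coprime_iff_gcd_eq_1)
  show "coprime [:- cis (2 * pi * (real k / real n)), 1:] (1 - monom 1 i)"
  proof (rule coprime_linear)
    have "real i * (2 * pi * (real k / real n)) = 2 * pi * real (k * i) / real n"
      by simp
    then have "cis (2 * pi * (real k / real n)) ^ i = cis (2 * pi * real (k * i) / real n)"
      by (simp only: Complex.DeMoivre)
    also have "\<dots> = exp (2 * of_real pi * \<i> * of_nat (k * i) / of_nat n)"
      by (simp add: cis_conv_exp mult_ac)
    finally have "cis (2 * pi * (real k / real n)) ^ i =
        exp (2 * of_real pi * \<i> * of_nat (k * i) / of_nat n)" .
    moreover have "\<not> n dvd k * i"
      using co assms(2) by (simp add: coprime_dvd_mult_right_iff)
    ultimately show "poly (1 - monom 1 i) (cis (2 * pi * (real k / real n))) \<noteq> 0"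
      using complex_root_unity_eq_1[of n "k * i"] assms(1) by (simp add: poly_monom)
  qed
qed

text \<open>
  Coprimality is required over \<open>\<complex>\<close> only. In \<open>\<int>[q]\<close> the factor \<open>b\<close> need not be invertible modulo
  \<open>\<Phi>\<^sub>n\<close>: for a prime \<open>n\<close> the ideal generated by \<open>1 - q\<close> and \<open>\<Phi>\<^sub>n\<close> contains \<open>n\<close> but not \<open>1\<close>.
\<close>

lemma cyclotomic_square_cancel:
  assumes "n > 0" "coprime (cyclotomic_complex n) (map_poly of_int b)"
    and "cyclotomic n ^ 2 dvd b * a"
  shows "cyclotomic n ^ 2 dvd a"
proof (rule monic_dvd_of_int)
  have eq: "map_poly of_int (cyclotomic n ^ 2) = cyclotomic_complex n ^ 2"
    by (simp add: power2_eq_square map_poly_of_int_mult of_int_cyclotomic[OF assms(1)])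
  have "cyclotomic_complex n ^ 2 dvd map_poly of_int b * map_poly of_int a"
    using assms(3) unfolding eq[symmetric] by (metis dvd_def map_poly_of_int_mult)
  moreover have "coprime (cyclotomic_complex n ^ 2) (map_poly of_int b)"
    using assms(2) by simp
  ultimately show "map_poly of_int (cyclotomic n ^ 2) dvd (map_poly of_int a :: complex poly)"
    unfolding eq by (simp add: coprime_dvd_mult_right_iff)
qed (simp add: lead_coeff_power lead_coeff_cyclotomic[OF assms(1)])

lemma cyclotomic_modulus_cyclotomic:
  assumes "n > 0"
  shows "cyclotomic_modulus q (cyclotomic n) n"
proof
  show "cyclotomic n ^ 2 dvd a" if "\<not> n dvd i" "cyclotomic n ^ 2 dvd (1 - q ^ i) * a" for i a
    using cyclotomic_square_cancel[OF assms _ that(2)] coprime_cyclotomic_complex[OF assms that(1)]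
    by (simp only: map_poly_one_minus_q_power)
  show "cyclotomic n ^ 2 dvd a" if "cyclotomic n ^ 2 dvd 2 * a" for a
  proof (rule cyclotomic_square_cancel[OF assms _ that])
    have "map_poly of_int 2 = ([:2:] :: complex poly)"
      by (intro poly_eqI) (simp add: coeff_map_poly numeral_poly coeff_pCons split: nat.split)
    moreover have "is_unit [:2 :: complex:]"
      by (simp add: is_unit_pCons_iff)
    ultimately show "coprime (cyclotomic_complex n) (map_poly of_int 2)"
      by (metis is_unit_right_imp_coprime)
  qed
qed (use assms q_power_neq_1 cyclotomic_dvd in auto)

lemma qtrinom_eq:
  assumes "n > 0"
  shows "qtrinom (2 * n) (int n) = cyclotomic_modulus.trinom q n"
  unfolding qtrinom_def cyclotomic_modulus.trinom_def[OF cyclotomic_modulus_cyclotomic[OF assms]]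
  atLeast0AtMost
proof (rule sum.cong[OF refl])
  fix k
  have "nat (int k * (int k + int n)) = k * (k + n)" "int k + int n = int (k + n)"
    by (simp_all add: nat_mult_distrib nat_add_distrib)
  then show "q ^ nat (int k * (int k + int n)) * qbinom (2 * n) (int k) * qbinom (2 * n - k) (int k + int n) =
      q ^ (k * (k + n)) * gauss q (2 * n) k * gauss q (2 * n - k) (k + n)"
    by (simp only: qbinom_eq_gauss)
qed

theorem theorem1p2:
  fixes n :: nat
  assumes "n > 0"
  shows "(\<forall>m::nat. n = 3 * m \<longrightarrow>
            cyclotomic n ^ 2 dvd
              qtrinom (2 * n) (int n)
              - (2 * (-1) ^ m * (1 + q ^ m) * q ^ (m * (3 * m - 1) div 2)
                 - of_nat (3 * m) * (1 - q ^ (3 * m))))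
       \<and> (\<forall>m::nat. n = 3 * m + 1 \<longrightarrow>
            cyclotomic n ^ 2 dvd
              qtrinom (2 * n) (int n)
              - (2 * (-1) ^ m * q ^ (m * (3 * m + 1) div 2)
                 - of_nat (3 * m + 1) * (1 - q ^ (3 * m + 1))))
       \<and> (\<forall>m::nat. n = 3 * m - 1 \<longrightarrow>
            cyclotomic n ^ 2 dvd
              qtrinom (2 * n) (int n)
              - (2 * (-1) ^ m * q ^ (m * (3 * m - 1) div 2)
                 - of_nat (3 * m - 1) * (1 - q ^ (3 * m - 1))))"
proof -
  interpret cyclotomic_modulus q "cyclotomic n" n
    by (rule cyclotomic_modulus_cyclotomic[OF assms])
  show ?thesis
    unfolding qtrinom_eq[OF assms]
  proof (intro conjI allI impI)
    fix m assume n: "n = 3 * m"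
    show "cyclotomic n ^ 2 dvd trinom
        - (2 * (-1) ^ m * (1 + q ^ m) * q ^ (m * (3 * m - 1) div 2) - of_nat (3 * m) * (1 - q ^ (3 * m)))"
      using trinom_cong_3m[OF n] unfolding cong_mod_def n[symmetric] .
  next
    fix m assume n: "n = 3 * m + 1"
    show "cyclotomic n ^ 2 dvd trinom
        - (2 * (-1) ^ m * q ^ (m * (3 * m + 1) div 2) - of_nat (3 * m + 1) * (1 - q ^ (3 * m + 1)))"
      using trinom_cong_3m_plus_1[OF n] unfolding cong_mod_def n[symmetric] .
  next
    fix m assume n: "n = 3 * m - 1"
    show "cyclotomic n ^ 2 dvd trinom
        - (2 * (-1) ^ m * q ^ (m * (3 * m - 1) div 2) - of_nat (3 * m - 1) * (1 - q ^ (3 * m - 1)))"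
      using trinom_cong_3m_minus_1[OF n] unfolding cong_mod_def n[symmetric] .
  qed
qed

end
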